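(* Let $f:\mathbb{R}^n\to\mathbb{R}^n$ be $C^\infty$. For $x_0\in\mathbb{R}^n$ let $\psi(x_0,t)$ be the solution of $\dot x=f(x)$ with initial condition $x_0$ at time $t=0$, let $\tau_N(x_0,t)=\sum_{i=0}^N \mathcal{L}^i_f 1_{\mathbb{R}^n}(x_0)\frac{t^i}{i!}$ be the Taylor approximation of order $N$ of $\psi(x_0,t)$ at $t=0$, and let $R(x_0)$ be its radius of convergence. Then there exists a sequence of $N$-polyflow approximations $(\pi_N)_{N\ge 1}$ of $\dot x=f(x)$ (i.e. for every integer $N\ge1$ there exist matrices $\Lambda_{N,0},\dots,\Lambda_{N,N-1}\in\mathbb{R}^{n\times n}$, not depending on $x_0$, with associated trajectories $\pi_N(x_0,t)$) such that: (1) for every $x_0\in\mathbb{R}^n$ and every $N\ge 1$, $\lim_{t\to\infty}\pi_N(x_0,t)=0$; (2) for every initial condition $x_0\in\mathbb{R}^n$ and every $t\in\,]-R(x_0),R(x_0)[$, the successive approximations tend pointwise to the true solution: $\lim_{N\to\infty}\pi_N(x_0,t)=\psi(x_0,t)$.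
   Context: Lie derivatives: for a $C^\infty$ function $g:\mathbb{R}^n\to\mathbb{R}$, $\mathcal{L}^0_f g=g$ and $\mathcal{L}^N_f g=\frac{\partial(\mathcal{L}^{N-1}_f g)}{\partial x}f$ for $N\ge1$; for vector-valued $g$ the Lie derivative is taken componentwise. $1_{\mathbb{R}^n}$ denotes the identity map of $\mathbb{R}^n$, so $\mathcal{L}^0_f1_{\mathbb{R}^n}(x)=x$ and $\mathcal{L}^1_f1_{\mathbb{R}^n}=f$. Radius of convergence: $R(x_0)$ is the largest $R\ge 0$ (possibly $\infty$) such that the series $\sum_{i=0}^\infty \mathcal{L}^i_f1_{\mathbb{R}^n}(x_0)\frac{t^i}{i!}$ converges for every $t\in\,]-R,R[$. $N$-polyflow approximation: given matrices $\Lambda_{N,0},\dots,\Lambda_{N,N-1}\in\mathbb{R}^{n\times n}$ (regarded as coefficients of an approximation $\sum_{i=0}^{N-1}\Lambda_{N,i}\mathcal{L}^i_f1$ of $\mathcal{L}^N_f1$; no particular way of choosing them is prescribed), the corresponding polyflow approximation of $\dot x=f(x)$ is the linear differential equation on $\mathbb{R}^{nN}$ in the block variables $z_0,\dots,z_{N-1}\in\mathbb{R}^n$ given by $$\dot z_i=z_{i+1}\ (0\le i\le N-2),\qquad \dot z_{N-1}=\sum_{i=0}^{N-1}\Lambda_{N,i}z_i,$$ with initial conditions $z_i(0)=\mathcal{L}^i_f1_{\mathbb{R}^n}(x_0)$ for $0\le i\le N-1$ (in particular $z_0(0)=x_0$). Its trajectory $\pi_N(x_0,t)$ is the first block $z_0(t)$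 of the solution, defined for all $t\in\mathbb{R}$.
   Formalization: In part (2) convergence to ψ(x_0,t) is proved only when the solution ψ(x_0,·) is real analytic in t on an open interval containing 0 and t; for merely C^∞ f the literal claim fails, e.g. n=1, f=1 for x≤0 and f>1 for x>0. *)

theory Defs
  imports "HOL-Analysis.Analysis"
begin

primrec n_times_differentiable ::
  "nat \<Rightarrow> ('a::real_normed_vector \<Rightarrow> 'b::real_normed_vector) \<Rightarrow> bool" where
  "n_times_differentiable 0 f \<longleftrightarrow> continuous_on UNIV f"
| "n_times_differentiable (Suc k) f \<longleftrightarrow>
     (\<forall>x. f differentiable (at x)) \<and>
     (\<forall>v. n_times_differentiable k (\<lambda>x. frechet_derivative f (at x) v))"

definition smooth :: "('a::real_normed_vector \<Rightarrow> 'b::real_normed_vector) \<Rightarrow> bool" where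
  "smooth f \<longleftrightarrow> (\<forall>k. n_times_differentiable k f)"

primrec lie_derivative ::
  "(real^'n \<Rightarrow> real^'n) \<Rightarrow> nat \<Rightarrow> (real^'n \<Rightarrow> real) \<Rightarrow> real^'n \<Rightarrow> real" where
  "lie_derivative f 0 g = g"
| "lie_derivative f (Suc N) g =
     (\<lambda>x. frechet_derivative (lie_derivative f N g) (at x) (f x))"

definition lie_derivative_vec ::
  "(real^'n \<Rightarrow> real^'n) \<Rightarrow> nat \<Rightarrow> (real^'n \<Rightarrow> real^'m) \<Rightarrow> real^'n \<Rightarrow> real^'m" where
  "lie_derivative_vec f N g x = (\<chi> k. lie_derivative f N (\<lambda>y. g y $ k) x)"

definition taylor_approx :: "(real^'n \<Rightarrow> real^'n) \<Rightarrow> nat \<Rightarrow> real^'n \<Rightarrow> real \<Rightarrow> real^'n" where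
  "taylor_approx f N x0 t = (\<Sum>i\<le>N. (t ^ i / fact i) *\<^sub>R lie_derivative_vec f i id x0)"

text \<open>
  The library's \<^const>\<open>conv_radius\<close> comes with its power series lemmas only for coefficients in a
  normed division algebra, so the radius is defined directly. The supremum is attained
  (lemma \<open>taylor_radius_convergent\<close>).
\<close>

definition taylor_radius :: "(real^'n \<Rightarrow> real^'n) \<Rightarrow> real^'n \<Rightarrow> ereal" where
  "taylor_radius f x0 =
     Sup {r. 0 \<le> r \<and> (\<forall>t. ereal \<bar>t\<bar> < r \<longrightarrow> convergent (\<lambda>N. taylor_approx f N x0 t))}"

lemma taylor_radius_nonneg: "0 \<le> taylor_radius f x0"
  unfolding taylor_radius_def by (rule Sup_upper) auto

lemma taylor_radius_convergent:
  "ereal \<bar>t\<bar> < taylor_radius f x0 \<Longrightarrow> convergent (\<lambda>N. taylor_approx f N x0 t)"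
  unfolding taylor_radius_def less_Sup_iff by auto

text \<open>
  \<open>ivp_solution f x0 J \<psi>\<close>: on the open interval \<open>J\<close> around 0, \<open>\<psi>\<close> solves \<open>x' = f x\<close>, \<open>x 0 = x0\<close>.
  Solutions need not exist for all times. For smooth \<open>f\<close> any two of them agree on the
  intersection of their intervals.
\<close>

definition ivp_solution ::
  "(real^'n \<Rightarrow> real^'n) \<Rightarrow> real^'n \<Rightarrow> real set \<Rightarrow> (real \<Rightarrow> real^'n) \<Rightarrow> bool" where
  "ivp_solution f x0 J \<psi> \<longleftrightarrow>
     open J \<and> is_interval J \<and> 0 \<in> J \<and> \<psi> 0 = x0 \<and>
     (\<forall>t\<in>J. (\<psi> has_vector_derivative f (\<psi> t)) (at t))"

text \<open>
  A smooth \<open>f\<close> may have solutions that are not the sum of their convergent Taylor series. For such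
  \<open>f\<close> there need not be any polyflow approximations, with coefficients independent of the initial
  condition, that tend to the solution within the radius of convergence of the Taylor series. For
  example, take \<open>f (x, y) = (1, g x)\<close> with \<open>g\<close> smooth, \<open>g x = 0\<close> for \<open>x \<le> 0\<close>, \<open>g x > 0\<close> for
  \<open>x > 0\<close>. For initial conditions \<open>(a, 0)\<close> with \<open>a \<le> 0\<close> this radius is infinite, and at a fixed
  time every polyflow approximation is an affine function of \<open>a\<close>. The second component of the
  solution at time 2, however, is 0 for \<open>a = -3\<close> and \<open>a = -2\<close>, and positive for \<open>a = -1\<close>.
  Hence convergence is claimed for analytic solutions; if \<open>f\<close> is real analytic, every solution is.
\<close>

definition real_analytic_curve_on :: "(real \<Rightarrow> 'a::real_normed_vector) \<Rightarrow> real set \<Rightarrow> bool" where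
  "real_analytic_curve_on \<psi> J \<longleftrightarrow>
     (\<forall>s\<in>J. \<exists>r>0. \<exists>a. \<forall>t. \<bar>t - s\<bar> < r \<longrightarrow> (\<lambda>i. (t - s) ^ i *\<^sub>R a i) sums \<psi> t)"

text \<open>Only the matrices \<open>\<Lambda> i\<close> and the blocks \<open>z i\<close> with \<open>i < N\<close> matter; \<open>N \<ge> 1\<close> is intended.\<close>

definition polyflow_solution ::
  "nat \<Rightarrow> (nat \<Rightarrow> real^'n^'n) \<Rightarrow> (nat \<Rightarrow> real \<Rightarrow> real^'n) \<Rightarrow> bool" where
  "polyflow_solution N \<Lambda> z \<longleftrightarrow>
     (\<forall>t. (\<forall>i. i + 1 < N \<longrightarrow> (z i has_vector_derivative z (i + 1) t) (at t)) \<and>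
          (z (N - 1) has_vector_derivative (\<Sum>i<N. \<Lambda> i *v z i t)) (at t))"

definition polyflow_trajectory ::
  "(real^'n \<Rightarrow> real^'n) \<Rightarrow> nat \<Rightarrow> (nat \<Rightarrow> real^'n^'n) \<Rightarrow> real^'n \<Rightarrow> (real \<Rightarrow> real^'n) \<Rightarrow> bool" where
  "polyflow_trajectory f N \<Lambda> x0 p \<longleftrightarrow>
     (\<exists>z. polyflow_solution N \<Lambda> z \<and>
          (\<forall>i<N. z i 0 = lie_derivative_vec f i id x0) \<and> p = z 0)"

end

(* Take scalar matrices that give every component the characteristic polynomial (s+1)^N. With
   c_i the i-th Lie derivative of the identity at x0, the polyflow trajectory is
     pi_N(t) = e^{-t} * sum_{j<N} (sum_{i<=j} (j choose i) c_i) t^j / j!,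
   which decays, since it is a polynomial times e^{-t}. The sum is a partial sum of the Cauchy
   product of the series sum_i c_i t^i / i! and e^t, so inside the radius of convergence pi_N(t)
   tends to the Taylor series. An analytic solution equals its Taylor series near 0, because Lie
   derivatives along a solution are time derivatives, and then as far as both are defined, by the
   identity theorem applied to complex extensions of the local power series. *)
theory Submission
  imports Defs "HOL-Complex_Analysis.Conformal_Mappings"
begin

section \<open>Smooth functions and Lie derivatives\<close>

lemma n_times_differentiable_SucD:
  "n_times_differentiable (Suc k) f \<Longrightarrow> n_times_differentiable k f"
proof (induction k arbitrary: f)
  case 0
  then show ?case
    by (auto intro!: continuous_at_imp_continuous_on differentiable_imp_continuous_within)
next
  case (Suc k)
  then show ?case by (metis n_times_differentiable.simps(2))
qed

lemma n_times_differentiable_const: "n_times_differentiable k (\<lambda>x. c)"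
  by (induction k arbitrary: c) auto

lemma n_times_differentiable_bounded_linear:
  assumes "bounded_linear L"
  shows "n_times_differentiable k L"
proof (cases k)
  case 0
  then show ?thesis using assms by (simp add: linear_continuous_on)
next
  case (Suc m)
  have "frechet_derivative L (at x) = L" for x
    using bounded_linear_imp_has_derivative[OF assms] frechet_derivative_at by metis
  then show ?thesis
    using Suc bounded_linear_imp_differentiable[OF assms] n_times_differentiable_const by auto
qed

lemma n_times_differentiable_compose_linear:
  assumes "bounded_linear L" "n_times_differentiable k f"
  shows "n_times_differentiable k (\<lambda>x. L (f x))"
  using assms(2)
proof (induction k arbitrary: f)
  case 0
  then show ?case
    using assms(1) by (auto intro: bounded_linear.continuous_on)
next
  case (Suc k)
  have d: "((\<lambda>x. L (f x)) has_derivative (\<lambda>v. L (frechet_derivative f (at x) v))) (at x)" for x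
    using Suc.prems
    by (intro bounded_linear.has_derivative[OF assms(1)]) (simp add: frechet_derivative_works)
  then have "frechet_derivative (\<lambda>x. L (f x)) (at x) = (\<lambda>v. L (frechet_derivative f (at x) v))" for x
    by (metis frechet_derivative_at)
  with d Suc show ?case by (auto simp: differentiable_def)
qed

lemma n_times_differentiable_add:
  assumes "n_times_differentiable k f" "n_times_differentiable k g"
  shows "n_times_differentiable k (\<lambda>x. f x + g x)"
  using assms
proof (induction k arbitrary: f g)
  case 0
  then show ?case by (auto intro: continuous_intros)
next
  case (Suc k)
  have d: "((\<lambda>x. f x + g x) has_derivative
      (\<lambda>v. frechet_derivative f (at x) v + frechet_derivative g (at x) v)) (at x)" for x
    using Suc.prems by (intro has_derivative_add) (auto simp: frechet_derivative_works)
  then have "frechet_derivative (\<lambda>x. f x + g x) (at x)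
      = (\<lambda>v. frechet_derivative f (at x) v + frechet_derivative g (at x) v)" for x
    by (metis frechet_derivative_at)
  with d Suc show ?case by (auto simp: differentiable_def)
qed

lemma n_times_differentiable_sum:
  assumes "\<And>i. i \<in> A \<Longrightarrow> n_times_differentiable k (f i)"
  shows "n_times_differentiable k (\<lambda>x. \<Sum>i\<in>A. f i x)"
  using assms
  by (induction A rule: infinite_finite_induct)
    (auto intro: n_times_differentiable_const n_times_differentiable_add)

lemma n_times_differentiable_mult:
  fixes f g :: "'a::real_normed_vector \<Rightarrow> real"
  assumes "n_times_differentiable k f" "n_times_differentiable k g"
  shows "n_times_differentiable k (\<lambda>x. f x * g x)"
  using assms
proof (induction k arbitrary: f g)
  case 0
  then show ?case by (auto intro: continuous_intros)
next
  case (Suc k)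
  have d: "((\<lambda>x. f x * g x) has_derivative
      (\<lambda>v. f x * frechet_derivative g (at x) v + frechet_derivative f (at x) v * g x)) (at x)" for x
    using Suc.prems by (intro has_derivative_mult) (auto simp: frechet_derivative_works)
  then have "frechet_derivative (\<lambda>x. f x * g x) (at x)
      = (\<lambda>v. f x * frechet_derivative g (at x) v + frechet_derivative f (at x) v * g x)" for x
    by (metis frechet_derivative_at)
  \<comment> \<open>Factors left undifferentiated are \<open>Suc k\<close> times differentiable, one
    order more than the induction hypothesis asks for.\<close>
  moreover have "n_times_differentiable k
      (\<lambda>x. f x * frechet_derivative g (at x) v + frechet_derivative f (at x) v * g x)" for v
    using Suc.prems
    by (intro n_times_differentiable_add Suc.IH) (auto intro: n_times_differentiable_SucD)
  ultimately show ?case using d by (auto simp: differentiable_def)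
qed

lemma smooth_imp_differentiable: "smooth g \<Longrightarrow> g differentiable (at x)"
  unfolding smooth_def by (metis n_times_differentiable.simps(2))

text \<open>\<open>smooth\<close> speaks of derivatives in fixed directions, while the direction
  \<open>f x\<close> moves with \<open>x\<close>. Expanding \<open>f x\<close> in the standard basis
  leaves products of coordinates of \<open>f\<close> with derivatives of \<open>g\<close> in the
  fixed directions \<open>axis i 1\<close>.\<close>

lemma smooth_directional_derivative:
  fixes f :: "real^'n \<Rightarrow> real^'n" and g :: "real^'n \<Rightarrow> real"
  assumes "smooth f" "smooth g"
  shows "smooth (\<lambda>x. frechet_derivative g (at x) (f x))"
proof -
  have "frechet_derivative g (at x) (f x)
      = (\<Sum>i\<in>UNIV. f x $ i * frechet_derivative g (at x) (axis i 1))" for x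
  proof -
    have "linear (frechet_derivative g (at x))"
      by (intro linear_frechet_derivative smooth_imp_differentiable assms)
    then have "frechet_derivative g (at x) (\<Sum>i\<in>UNIV. f x $ i *\<^sub>R axis i 1)
        = (\<Sum>i\<in>UNIV. f x $ i * frechet_derivative g (at x) (axis i 1))"
      by (simp add: linear_sum linear_scale)
    then show ?thesis
      using basis_expansion[of "f x"] by (simp add: scalar_mult_eq_scaleR)
  qed
  moreover have "n_times_differentiable k
      (\<lambda>x. \<Sum>i\<in>UNIV. f x $ i * frechet_derivative g (at x) (axis i 1))" for k
  proof (intro n_times_differentiable_sum n_times_differentiable_mult)
    show "n_times_differentiable k (\<lambda>x. f x $ i)" for i
      using assms(1) n_times_differentiable_compose_linear[OF bounded_linear_vec_nth, of k f i]
      by (simp add: smooth_def)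
    have "n_times_differentiable (Suc k) g"
      using assms(2) by (simp only: smooth_def)
    then show "n_times_differentiable k (\<lambda>x. frechet_derivative g (at x) (axis i 1))" for i
      by simp
  qed
  ultimately show ?thesis by (simp add: smooth_def)
qed

lemma smooth_lie_derivative:
  assumes "smooth f" "smooth g"
  shows "smooth (lie_derivative f m g)"
  using assms by (induction m) (auto intro: smooth_directional_derivative)

lemma smooth_coordinate: "smooth (\<lambda>x::real^'n. x $ k)"
  unfolding smooth_def by (simp add: n_times_differentiable_bounded_linear bounded_linear_vec_nth)

text \<open>Chain rule, with the velocity \<open>f (\<psi> t)\<close> as the direction. Iterated
  over \<open>m\<close>, it supplies the chain of derivatives that
  \<open>power_series_coeff_iterated_deriv\<close> takes as \<open>g\<close>.\<close>

lemma lie_derivative_along_solution: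
  assumes "smooth f" "smooth g" "(\<psi> has_vector_derivative f (\<psi> t)) (at t)"
  shows "((\<lambda>t. lie_derivative f m g (\<psi> t)) has_real_derivative
    lie_derivative f (Suc m) g (\<psi> t)) (at t)"
proof -
  have "(lie_derivative f m g has_derivative
      frechet_derivative (lie_derivative f m g) (at (\<psi> t))) (at (\<psi> t))"
    using smooth_lie_derivative[OF assms(1,2)]
    by (simp add: smooth_imp_differentiable frechet_derivative_works[symmetric])
  from vector_derivative_diff_chain_within[OF assms(3) has_derivative_at_withinI[OF this]]
  show ?thesis by (simp add: has_real_derivative_iff_has_vector_derivative o_def)
qed

section \<open>Real power series\<close>

text \<open>Termwise differentiation acts on coefficients by \<open>diffs\<close>, so
  \<open>g m\<close> has the coefficients \<open>(diffs ^^ m) a\<close>. At 0 only the constant one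
  survives, and it equals \<open>fact m * a m\<close>.\<close>

lemma power_series_coeff_iterated_deriv:
  fixes a :: "nat \<Rightarrow> real"
  assumes "r > 0" "\<And>t. \<bar>t\<bar> < r \<Longrightarrow> (\<lambda>i. a i * t ^ i) sums g 0 t"
    and deriv: "\<And>m t. \<bar>t\<bar> < r \<Longrightarrow> (g m has_real_derivative g (Suc m) t) (at t)"
  shows "a m = g m 0 / fact m"
proof -
  have sums: "(\<lambda>i. (diffs ^^ m) a i * t ^ i) sums g m t" if "\<bar>t\<bar> < r" for t
    using that
  proof (induction m arbitrary: t)
    case (Suc m)
    have "(\<lambda>i. diffs ((diffs ^^ m) a) i * t ^ i) sums g (Suc m) t"
      using Suc deriv by (intro termdiffs_sums_strong[where K = r and f = "g m"]) auto
    then show ?case by simp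
  qed (use assms in simp)
  have coeff: "fact n * (diffs ^^ m) a n = fact (n + m) * a (n + m)" for n
  proof (induction m arbitrary: n)
    case (Suc m)
    show ?case
      using Suc[of "Suc n"] by (simp add: diffs_def algebra_simps)
  qed simp
  have "(\<lambda>i. (diffs ^^ m) a i * 0 ^ i) sums ((diffs ^^ m) a 0)"
    by (rule powser_sums_zero)
  then have "(diffs ^^ m) a 0 = g m 0"
    using sums[of 0] \<open>r > 0\<close> sums_unique2 by fastforce
  then show ?thesis using coeff[of 0] by (simp add: field_simps)
qed

section \<open>Complex extension and the identity theorem\<close>

lemma summable_complex_power_series:
  fixes a :: "nat \<Rightarrow> real" and z :: complex
  assumes "\<And>t. \<bar>t\<bar> < r \<Longrightarrow> summable (\<lambda>i. a i * t ^ i)" "norm z < r"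
  shows "summable (\<lambda>i. of_real (a i) * z ^ i)"
proof -
  \<comment> \<open>Convergence at a real point farther from 0 than \<open>z\<close> forces
    convergence at \<open>z\<close>.\<close>
  obtain t where t: "norm z < t" "t < r" using dense assms(2) by blast
  then have "0 < t" using norm_ge_zero[of z] by linarith
  with t have "summable (\<lambda>i. a i * t ^ i)" by (intro assms) simp
  then have "summable (\<lambda>i. complex_of_real (a i * t ^ i))" by (rule summable_of_real)
  then have "summable (\<lambda>i. of_real (a i) * complex_of_real t ^ i)" by simp
  then show ?thesis
    by (rule powser_inside) (use t \<open>0 < t\<close> in simp)
qed

lemma holomorphic_complex_power_series:
  fixes a :: "nat \<Rightarrow> real"
  assumes "\<And>t. \<bar>t\<bar> < r \<Longrightarrow> summable (\<lambda>i. a i * t ^ i)"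
  shows "(\<lambda>z. \<Sum>i. of_real (a i) * z ^ i) holomorphic_on ball (0::complex) r"
proof (rule holomorphic_onI)
  fix z :: complex
  assume "z \<in> ball 0 r"
  then have "((\<lambda>z. \<Sum>i. of_real (a i) * z ^ i) has_field_derivative
      (\<Sum>i. diffs (\<lambda>i. of_real (a i)) i * z ^ i)) (at z)"
    using summable_complex_power_series[OF assms]
    by (intro termdiffs_strong'[where K = r]) auto
  then show "(\<lambda>z. \<Sum>i. of_real (a i) * z ^ i) field_differentiable (at z within ball 0 r)"
    using field_differentiable_at_within field_differentiable_def by blast
qed

lemma suminf_complex_power_series:
  fixes a :: "nat \<Rightarrow> real"
  assumes "(\<lambda>i. a i * t ^ i) sums s"
  shows "(\<Sum>i. of_real (a i) * complex_of_real t ^ i) = of_real s"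
proof -
  have "(\<lambda>i. complex_of_real (a i * t ^ i)) sums of_real s"
    using assms by (rule sums_of_real)
  then show ?thesis by (simp add: sums_iff)
qed

text \<open>Both series extend holomorphically to the complex disc of radius \<open>r\<close> about
  \<open>t\<close>; for the one centred at 0 this is what \<open>\<bar>t\<bar> + r \<le> R\<close>
  provides. The extensions agree on a real interval around \<open>x\<close>, which accumulates at
  \<open>x\<close>, so analytic continuation carries equality to \<open>y\<close>.\<close>

lemma power_series_agree:
  fixes F G :: "real \<Rightarrow> real"
  assumes F: "\<And>u. \<bar>u - t\<bar> < r \<Longrightarrow> (\<lambda>i. a i * (u - t) ^ i) sums F u"
    and G: "\<And>u. \<bar>u\<bar> < R \<Longrightarrow> (\<lambda>i. c i * u ^ i) sums G u"
    and "\<bar>t\<bar> + r \<le> R"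
    and x: "\<bar>x - t\<bar> < r" and "0 < e" and eq: "\<And>u. \<bar>u - x\<bar> < e \<Longrightarrow> F u = G u"
    and y: "\<bar>y - t\<bar> < r"
  shows "F y = G y"
proof -
  let ?P = "\<lambda>a z. \<Sum>i. of_real (a i) * z ^ i :: complex"
  let ?B = "ball (complex_of_real t) r"
  let ?h = "\<lambda>z. ?P a (z - of_real t) - ?P c z"
  have sub: "\<bar>u\<bar> < R" if "\<bar>u - t\<bar> < r" for u
    using that \<open>\<bar>t\<bar> + r \<le> R\<close> by linarith
  have h: "?h (of_real u) = of_real (F u - G u)" if "\<bar>u - t\<bar> < r" for u
    using suminf_complex_power_series[OF F[OF that]] suminf_complex_power_series[OF G[OF sub[OF that]]]
    by simp
  have "summable (\<lambda>i. a i * s ^ i)" if "\<bar>s\<bar> < r" for s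
    using F[of "s + t"] that by (simp add: sums_iff)
  then have "?P a holomorphic_on ball 0 r"
    by (rule holomorphic_complex_power_series)
  then have "(?P a \<circ> (\<lambda>z. z - of_real t)) holomorphic_on ?B"
    by (intro holomorphic_on_compose_gen[where t = "ball 0 r"] holomorphic_intros)
      (auto simp: dist_norm norm_minus_commute)
  moreover have "?P c holomorphic_on ball 0 R"
    using G by (intro holomorphic_complex_power_series) (auto simp: sums_iff)
  then have "?P c holomorphic_on ?B"
  proof (rule holomorphic_on_subset)
    show "?B \<subseteq> ball 0 R"
    proof
      fix z
      assume "z \<in> ?B"
      then have "norm (z - of_real t) < r" by (simp add: dist_norm norm_minus_commute)
      with norm_triangle_sub[of z "of_real t"] \<open>\<bar>t\<bar> + r \<le> R\<close> show "z \<in> ball 0 R" by simp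
    qed
  qed
  ultimately have holo: "?h holomorphic_on ?B"
    by (auto intro: holomorphic_on_diff simp: o_def)
  \<comment> \<open>The interval of radius \<open>d\<close> around \<open>x\<close> lies both where
    \<open>F\<close> and \<open>G\<close> are known to agree and inside the disc about
    \<open>t\<close>.\<close>
  define d where "d = min e (r - \<bar>x - t\<bar>)"
  have "d > 0" using \<open>0 < e\<close> x by (simp add: d_def)
  have lim: "complex_of_real x islimpt of_real ` ball x d"
    unfolding islimpt_approachable
  proof (intro allI impI)
    fix \<epsilon> :: real
    assume "\<epsilon> > 0"
    define u where "u = x + min \<epsilon> d / 2"
    have "u \<noteq> x" "\<bar>u - x\<bar> < \<epsilon>" "\<bar>u - x\<bar> < d"
      using \<open>\<epsilon> > 0\<close> \<open>d > 0\<close> by (auto simp: u_def)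
    then show "\<exists>w\<in>of_real ` ball x d. w \<noteq> complex_of_real x \<and> dist w (complex_of_real x) < \<epsilon>"
      by (intro bexI[of _ "of_real u"]) (auto simp: dist_real_def)
  qed
  have near: "\<bar>u - t\<bar> < r \<and> F u = G u" if "u \<in> ball x d" for u
    using that eq[of u] by (auto simp: d_def dist_real_def)
  have "?h (of_real y) = 0"
  proof (rule analytic_continuation[OF holo _ _ _ _ lim])
    show "of_real ` ball x d \<subseteq> ?B"
      using near by (auto simp: dist_real_def abs_minus_commute)
    show "complex_of_real x \<in> ?B" "complex_of_real y \<in> ?B"
      using x y by (auto simp: dist_real_def)
    show "?h z = 0" if "z \<in> of_real ` ball x d" for z
    proof -
      from that obtain u where "z = of_real u" "u \<in> ball x d" by blast
      with near[of u] h[of u] show ?thesis by simp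
    qed
  qed auto
  then have "complex_of_real (F y - G y) = 0" using h[OF y] by simp
  then show ?thesis by (simp only: of_real_eq_0_iff right_minus_eq)
qed

text \<open>A connectedness argument: every point of the interval has a ball in which agreement near
  one point spreads to all others, by \<open>power_series_agree\<close>. The property propagated is
  agreement on a neighbourhood, since agreement at a single point would not spread.\<close>

lemma real_analytic_curve_eq_power_series:
  fixes \<phi> :: "real \<Rightarrow> real"
  assumes J: "open J" "is_interval J" "0 \<in> J" "real_analytic_curve_on \<phi> J"
    and G: "\<And>u. \<bar>u\<bar> < R \<Longrightarrow> (\<lambda>i. c i * u ^ i) sums G u"
    and "0 < e" and eq: "\<And>u. \<bar>u\<bar> < e \<Longrightarrow> \<phi> u = G u"
    and t: "t \<in> J" "\<bar>t\<bar> < R"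
  shows "\<phi> t = G t"
proof -
  let ?I = "J \<inter> ball 0 R"
  have mem: "\<bar>u\<bar> < R" if "u \<in> ?I" for u using that by simp
  have "convex ?I" using J by (simp add: convex_Int is_interval_convex)
  moreover have "0 \<in> ?I" "t \<in> ?I" using J t by auto
  moreover have "\<exists>e>0. \<forall>u. \<bar>u - 0\<bar> < e \<longrightarrow> \<phi> u = G u" using \<open>0 < e\<close> eq by auto
  ultimately have "\<exists>e>0. \<forall>u. \<bar>u - t\<bar> < e \<longrightarrow> \<phi> u = G u"
  proof (rule connected_induction_simple[OF convex_connected])
    fix s
    assume s: "s \<in> ?I"
    then obtain r a where r: "r > 0"
      "\<And>u. \<bar>u - s\<bar> < r \<Longrightarrow> (\<lambda>i. (u - s) ^ i *\<^sub>R a i) sums \<phi> u"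
      using J(4) unfolding real_analytic_curve_on_def by blast
    have "open ?I" using J by auto
    with s obtain \<rho> where \<rho>: "\<rho> > 0" "ball s \<rho> \<subseteq> ?I"
      by (meson openE)
    \<comment> \<open>The ball of radius \<open>q\<close> about \<open>s\<close> must stay within
      the local expansion, within the interval, and within the disc where the series at 0
      converges.\<close>
    define q where "q = min (min r \<rho>) (R - \<bar>s\<bar>)"
    have q: "q > 0" "q \<le> r" "q \<le> \<rho>" "\<bar>s\<bar> + q \<le> R"
      using r \<rho> mem[OF s] by (auto simp: q_def)
    have agree: "\<phi> y = G y"
      if x: "\<bar>x - s\<bar> < q" and e': "0 < e'" "\<And>u. \<bar>u - x\<bar> < e' \<Longrightarrow> \<phi> u = G u"
        and y: "\<bar>y - s\<bar> < q" for x y e'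
    proof (rule power_series_agree[where F = \<phi> and G = G and a = a and c = c and t = s and r = q
            and R = R and e = e' and x = x])
      show "(\<lambda>i. a i * (u - s) ^ i) sums \<phi> u" if "\<bar>u - s\<bar> < q" for u
        using r(2)[of u] that q by (simp add: mult.commute)
      show "(\<lambda>i. c i * u ^ i) sums G u" if "\<bar>u\<bar> < R" for u
        using that by (rule G)
      show "\<phi> u = G u" if "\<bar>u - x\<bar> < e'" for u
        using that by (rule e'(2))
    qed (use q x y e'(1) in linarith)+
    show "\<exists>T. openin (top_of_set ?I) T \<and> s \<in> T \<and> (\<forall>x\<in>T. \<forall>y\<in>T.
        (\<exists>e>0. \<forall>u. \<bar>u - x\<bar> < e \<longrightarrow> \<phi> u = G u) \<longrightarrow> (\<exists>e>0. \<forall>u. \<bar>u - y\<bar> < e \<longrightarrow> \<phi> u = G u))"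
    proof (intro exI[of _ "ball s q"] conjI ballI impI)
      have "ball s q \<subseteq> ?I" using \<rho> q by auto
      then show "openin (top_of_set ?I) (ball s q)" by (simp add: open_subset)
      show "s \<in> ball s q" using q(1) by simp
      fix x y
      assume "x \<in> ball s q" "y \<in> ball s q"
      then have xy: "\<bar>x - s\<bar> < q" "\<bar>y - s\<bar> < q"
        by (simp_all add: dist_real_def abs_minus_commute)
      assume "\<exists>e>0. \<forall>u. \<bar>u - x\<bar> < e \<longrightarrow> \<phi> u = G u"
      then obtain e' where e': "e' > 0" "\<And>u. \<bar>u - x\<bar> < e' \<Longrightarrow> \<phi> u = G u" by blast
      show "\<exists>e>0. \<forall>u. \<bar>u - y\<bar> < e \<longrightarrow> \<phi> u = G u"
      proof (intro exI conjI allI impI)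
        show "q - \<bar>y - s\<bar> > 0" using xy(2) by simp
        fix u
        assume "\<bar>u - y\<bar> < q - \<bar>y - s\<bar>"
        then have "\<bar>u - s\<bar> < q" by linarith
        with xy(1) e' show "\<phi> u = G u" by (rule agree)
      qed
    qed
  qed
  then show ?thesis by auto
qed

section \<open>The Taylor series of an analytic solution\<close>

text \<open>The argument runs in one coordinate, because the complex extensions are made for real
  coefficients. Comparing coefficients at 0 gives equality near 0 only; the identity theorem takes
  it to \<open>t\<close>.\<close>

lemma taylor_series_sums_solution:
  fixes f :: "real^'n \<Rightarrow> real^'n"
  assumes "smooth f" and sol: "ivp_solution f x0 J \<psi>" and an: "real_analytic_curve_on \<psi> J"
    and sm: "\<And>u. \<bar>u\<bar> < R \<Longrightarrow> summable (\<lambda>i. (lie_derivative_vec f i id x0 $ k / fact i) * u ^ i)"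
    and t: "t \<in> J" "\<bar>t\<bar> < R"
  shows "(\<lambda>i. (lie_derivative_vec f i id x0 $ k / fact i) * t ^ i) sums (\<psi> t $ k)"
proof -
  define c where "c = (\<lambda>i. lie_derivative_vec f i id x0 $ k / fact i)"
  have J: "open J" "is_interval J" "0 \<in> J" and "\<psi> 0 = x0"
    and deriv: "\<And>t. t \<in> J \<Longrightarrow> (\<psi> has_vector_derivative f (\<psi> t)) (at t)"
    using sol unfolding ivp_solution_def by blast+
  define G where "G = (\<lambda>u. \<Sum>i. c i * u ^ i)"
  have G: "(\<lambda>i. c i * u ^ i) sums G u" if "\<bar>u\<bar> < R" for u
    using sm[OF that] by (simp add: c_def G_def summable_sums)
  have ank: "real_analytic_curve_on (\<lambda>t. \<psi> t $ k) J"
    unfolding real_analytic_curve_on_def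
  proof
    fix s
    assume "s \<in> J"
    with an obtain r a where ra: "r > 0" "\<And>t. \<bar>t - s\<bar> < r \<Longrightarrow> (\<lambda>i. (t - s) ^ i *\<^sub>R a i) sums \<psi> t"
      unfolding real_analytic_curve_on_def by blast
    have "(\<lambda>i. (t - s) ^ i *\<^sub>R (a i $ k)) sums (\<psi> t $ k)" if "\<bar>t - s\<bar> < r" for t
      using bounded_linear.sums[OF bounded_linear_vec_nth[of k] ra(2)[OF that]] by simp
    with ra(1) show "\<exists>r>0. \<exists>a. \<forall>t. \<bar>t - s\<bar> < r \<longrightarrow> (\<lambda>i. (t - s) ^ i *\<^sub>R a i) sums (\<psi> t $ k)"
      by (intro exI[of _ r] exI[of _ "\<lambda>i. a i $ k"] conjI allI impI)
  qed
  from openE[OF J(1,3)] obtain \<rho> where \<rho>: "\<rho> > 0" "ball 0 \<rho> \<subseteq> J" .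
  from ank J(3) obtain r a
    where ra0: "r > 0" "\<And>t. \<bar>t - 0\<bar> < r \<Longrightarrow> (\<lambda>i. (t - 0) ^ i *\<^sub>R a i) sums (\<psi> t $ k)"
    unfolding real_analytic_curve_on_def by blast
  then have ra: "r > 0" "\<And>t. \<bar>t\<bar> < r \<Longrightarrow> (\<lambda>i. t ^ i * a i) sums (\<psi> t $ k)"
    by simp_all
  \<comment> \<open>For times below \<open>q\<close> the solution is defined, equals its expansion
    at 0, and the Taylor series converges. Positivity of \<open>R\<close> comes from
    \<open>\<bar>t\<bar> < R\<close>.\<close>
  define q where "q = min (min \<rho> r) R"
  have q: "q > 0" "q \<le> \<rho>" "q \<le> r" "q \<le> R" using ra(1) \<rho>(1) t(2) by (auto simp: q_def)
  have "a m = lie_derivative f m (\<lambda>x. x $ k) (\<psi> 0) / fact m" for m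
  proof (rule power_series_coeff_iterated_deriv[where r = q and g = "\<lambda>m t. lie_derivative f m (\<lambda>x. x $ k) (\<psi> t)"])
    show "(\<lambda>i. a i * t ^ i) sums lie_derivative f 0 (\<lambda>x. x $ k) (\<psi> t)" if "\<bar>t\<bar> < q" for t
      using ra(2)[of t] that q by (simp add: mult.commute)
    show "((\<lambda>t. lie_derivative f m (\<lambda>x. x $ k) (\<psi> t)) has_real_derivative
        lie_derivative f (Suc m) (\<lambda>x. x $ k) (\<psi> t)) (at t)" if "\<bar>t\<bar> < q" for m t
    proof (rule lie_derivative_along_solution[OF assms(1) smooth_coordinate])
      have "t \<in> J" using that q \<rho> by (auto simp: subset_iff)
      then show "(\<psi> has_vector_derivative f (\<psi> t)) (at t)" by (rule deriv)
    qed
  qed (use q in auto)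
  then have "a = c" using \<open>\<psi> 0 = x0\<close> by (auto simp: c_def lie_derivative_vec_def fun_eq_iff)
  have near: "\<psi> u $ k = G u" if "\<bar>u\<bar> < q" for u
  proof (rule sums_unique2)
    show "(\<lambda>i. c i * u ^ i) sums (\<psi> u $ k)"
      using ra(2)[of u] that q \<open>a = c\<close> by (simp add: mult.commute)
    show "(\<lambda>i. c i * u ^ i) sums G u" using G that q by simp
  qed
  have "\<psi> t $ k = G t"
    using J ank G \<open>q > 0\<close> near t by (rule real_analytic_curve_eq_power_series)
  then show ?thesis using G[OF t(2)] by (simp add: c_def)
qed

lemma summable_taylor_component:
  assumes "ereal \<bar>t\<bar> < taylor_radius f x0"
  shows "summable (\<lambda>i. (lie_derivative_vec f i id x0 $ k / fact i) * t ^ i)"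
proof -
  from taylor_radius_convergent[OF assms]
  have "summable (\<lambda>i. (t ^ i / fact i) *\<^sub>R lie_derivative_vec f i id x0)"
    by (simp add: summable_iff_convergent' taylor_approx_def)
  from bounded_linear.summable[OF bounded_linear_vec_nth[of k] this]
  show ?thesis by (simp add: mult.commute)
qed

section \<open>The polyflow approximation with characteristic polynomial $(s+1)^N$\<close>

definition forward_diff :: "(nat \<Rightarrow> 'a::ab_group_add) \<Rightarrow> nat \<Rightarrow> 'a" where
  "forward_diff u j = u (Suc j) - u j"

lemma forward_diff_funpow_Suc:
  "(forward_diff ^^ Suc i) u j = (forward_diff ^^ i) u (Suc j) - (forward_diff ^^ i) u j"
  by (simp add: forward_diff_def[of "(forward_diff ^^ i) u"])

text \<open>On exponential generating functions this is multiplication by the exponential series; it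
  is inverted by taking forward differences at 0.\<close>

definition binomial_transform :: "(nat \<Rightarrow> 'a::real_vector) \<Rightarrow> nat \<Rightarrow> 'a" where
  "binomial_transform c j = (\<Sum>i\<le>j. real (j choose i) *\<^sub>R c i)"

text \<open>Pascal's rule.\<close>

lemma binomial_transform_Suc:
  "binomial_transform c (Suc j) = binomial_transform c j + binomial_transform (\<lambda>i. c (Suc i)) j"
proof -
  have "binomial_transform c (Suc j)
      = c 0 + (\<Sum>i\<le>j. real (Suc j choose Suc i) *\<^sub>R c (Suc i))"
    unfolding binomial_transform_def by (subst sum.atMost_Suc_shift) simp
  also have "\<dots> = (c 0 + (\<Sum>i\<le>j. real (j choose Suc i) *\<^sub>R c (Suc i)))
      + binomial_transform (\<lambda>i. c (Suc i)) j"
    by (simp add: binomial_transform_def scaleR_add_left sum.distrib)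
  also have "c 0 + (\<Sum>i\<le>j. real (j choose Suc i) *\<^sub>R c (Suc i))
      = (\<Sum>i\<le>Suc j. real (j choose i) *\<^sub>R c i)"
    by (subst sum.atMost_Suc_shift) simp
  \<comment> \<open>The additional top term has coefficient \<open>j choose Suc j\<close>, which is
    0.\<close>
  also have "\<dots> = binomial_transform c j"
    by (simp add: binomial_transform_def)
  finally show ?thesis .
qed

lemma forward_diff_binomial_transform:
  "(forward_diff ^^ i) (binomial_transform c) = binomial_transform (\<lambda>l. c (l + i))"
proof (induction i)
  case (Suc i)
  then show ?case by (auto simp: forward_diff_def binomial_transform_Suc fun_eq_iff)
qed simp

text \<open>Needed because \<open>exp_poly\<close> at time 0 reproduces the transform only at
  indices below \<open>N\<close>.\<close>

lemma forward_diff_cong: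
  assumes "\<And>l. l \<le> j + i \<Longrightarrow> u l = v l"
  shows "(forward_diff ^^ i) u j = (forward_diff ^^ i) v j"
  using assms
proof (induction i arbitrary: j)
  case (Suc i)
  then show ?case using Suc.IH[of j] Suc.IH[of "Suc j"] by (simp add: forward_diff_def)
qed simp

text \<open>Newton's formula: the shift is the identity plus \<open>forward_diff\<close>, and its
  \<open>N\<close>-th power expands binomially.\<close>

lemma newton_forward_expansion:
  fixes u :: "nat \<Rightarrow> 'a::real_vector"
  shows "binomial_transform (\<lambda>i. (forward_diff ^^ i) u j) N = u (j + N)"
proof (induction N arbitrary: u)
  case 0
  then show ?case by (simp add: binomial_transform_def)
next
  case (Suc N)
  have "binomial_transform (\<lambda>i. (forward_diff ^^ Suc i) u j) N
      = binomial_transform (\<lambda>i. (forward_diff ^^ i) (forward_diff u) j) N"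
    by (simp add: funpow_Suc_right del: funpow.simps)
  also have "\<dots> = u (j + Suc N) - u (j + N)"
    using Suc[of "forward_diff u"] by (simp add: forward_diff_def[of u "j + N"])
  finally show ?case
    using Suc[of u] by (simp add: binomial_transform_Suc del: funpow.simps)
qed

text \<open>
  Up to the factor \<open>e\<^bsup>-t\<^esup>\<close>, \<open>exp_poly N d j\<close> is the \<open>j\<close>-th derivative of the polynomial
  \<open>\<Sum>l<N. d l t\<^sup>l / l!\<close>. As differentiating \<open>e\<^bsup>-t\<^esup> q(t)\<close> applies \<open>D - 1\<close> to \<open>q\<close>, the blocks of the
  polyflow solution are forward differences in \<open>j\<close>.
\<close>

definition exp_poly :: "nat \<Rightarrow> (nat \<Rightarrow> 'a::real_normed_vector) \<Rightarrow> nat \<Rightarrow> real \<Rightarrow> 'a" where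
  "exp_poly N d j t = exp (- t) *\<^sub>R (\<Sum>l<N - j. (t ^ l / fact l) *\<^sub>R d (j + l))"

lemma exp_poly_has_vector_derivative:
  "(exp_poly N d j has_vector_derivative exp_poly N d (Suc j) t - exp_poly N d j t) (at t)"
proof -
  define Q where "Q = (\<lambda>j t. \<Sum>l<N - j. (t ^ l / fact l) *\<^sub>R d (j + l))"
  have "(Q j has_vector_derivative Q (Suc j) t) (at t)"
  \<comment> \<open>For \<open>j \<ge> N\<close> all sums are empty. Otherwise the constant term
    \<open>d j\<close> is split off, so that differentiation lowers every remaining power by
    one.\<close>
  proof (cases "N - j")
    case 0
    then have "Q j = (\<lambda>t. 0)" "Q (Suc j) t = 0" by (auto simp: Q_def)
    then show ?thesis by simp
  next
    case (Suc m)
    have "((\<lambda>t. t ^ Suc l / fact (Suc l)) has_real_derivative t ^ l / fact l) (at t)" for l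
      by (rule derivative_eq_intros refl | simp)+
    then have "((\<lambda>t. d j + (\<Sum>l<m. (t ^ Suc l / fact (Suc l)) *\<^sub>R d (j + Suc l))) has_vector_derivative
        0 + (\<Sum>l<m. (t ^ l / fact l) *\<^sub>R d (j + Suc l))) (at t)"
      by (intro has_vector_derivative_add has_vector_derivative_const has_vector_derivative_sum
          bounded_linear.has_vector_derivative[OF bounded_linear_scaleR_left])
        (simp only: has_real_derivative_iff_has_vector_derivative)
    moreover have "Q j = (\<lambda>t. d j + (\<Sum>l<m. (t ^ Suc l / fact (Suc l)) *\<^sub>R d (j + Suc l)))"
      unfolding Q_def Suc by (subst sum.lessThan_Suc_shift) simp
    moreover have "N - Suc j = m" using Suc by simp
    ultimately show ?thesis by (simp add: Q_def)
  qed
  moreover have "((\<lambda>t. exp (- t)) has_real_derivative - exp (- t)) (at t)"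
    by (auto intro!: derivative_eq_intros)
  ultimately have "((\<lambda>t. exp (- t) *\<^sub>R Q j t) has_vector_derivative
      exp (- t) *\<^sub>R Q (Suc j) t + (- exp (- t)) *\<^sub>R Q j t) (at t)"
    by (intro has_vector_derivative_scaleR)
  then show ?thesis by (simp add: exp_poly_def[abs_def] Q_def)
qed

lemma exp_poly_forward_diff_has_vector_derivative:
  "((\<lambda>t. (forward_diff ^^ i) (\<lambda>j. exp_poly N d j t) j) has_vector_derivative
    (forward_diff ^^ Suc i) (\<lambda>j. exp_poly N d j t) j) (at t)"
proof (induction i arbitrary: j)
  case 0
  then show ?case by (simp add: forward_diff_def exp_poly_has_vector_derivative)
next
  case (Suc i)
  have "((\<lambda>t. (forward_diff ^^ i) (\<lambda>j. exp_poly N d j t) (Suc j)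
        - (forward_diff ^^ i) (\<lambda>j. exp_poly N d j t) j) has_vector_derivative
      (forward_diff ^^ Suc i) (\<lambda>j. exp_poly N d j t) (Suc j)
        - (forward_diff ^^ Suc i) (\<lambda>j. exp_poly N d j t) j) (at t)"
    by (intro has_vector_derivative_diff Suc)
  then show ?case by (simp only: forward_diff_funpow_Suc)
qed

text \<open>Newton's formula from index 0 ends at \<open>exp_poly N d N t\<close>, an empty sum.
  Solving the resulting relation for its top difference, whose coefficient is 1, gives the last
  polyflow equation.\<close>

lemma exp_poly_forward_diff_sum:
  "(\<Sum>i<N. (- real (N choose i)) *\<^sub>R (forward_diff ^^ i) (\<lambda>j. exp_poly N d j t) 0)
    = (forward_diff ^^ N) (\<lambda>j. exp_poly N d j t) 0"
proof -
  have "binomial_transform (\<lambda>i. (forward_diff ^^ i) (\<lambda>j. exp_poly N d j t) 0) N = 0"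
    by (simp add: newton_forward_expansion exp_poly_def)
  then have "(\<Sum>i<N. real (N choose i) *\<^sub>R (forward_diff ^^ i) (\<lambda>j. exp_poly N d j t) 0)
      = - (forward_diff ^^ N) (\<lambda>j. exp_poly N d j t) 0"
    by (simp add: binomial_transform_def lessThan_Suc_atMost[symmetric] eq_neg_iff_add_eq_0)
  then show ?thesis by (simp add: sum_negf)
qed

lemma exp_poly_initial:
  assumes "i < N"
  shows "(forward_diff ^^ i) (\<lambda>j. exp_poly N (binomial_transform c) j 0) 0 = c i"
proof -
  have "exp_poly N (binomial_transform c) j 0 = binomial_transform c j" if "j \<le> i" for j
  proof -
    \<comment> \<open>The sum is nonempty, so its term \<open>l = 0\<close> is present, the only one
      that does not vanish at time 0.\<close>
    have "N - j = Suc (N - Suc j)" using that assms by simp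
    then show ?thesis by (simp add: exp_poly_def sum.lessThan_Suc_shift del: sum.lessThan_Suc)
  qed
  then have "(forward_diff ^^ i) (\<lambda>j. exp_poly N (binomial_transform c) j 0) 0
      = (forward_diff ^^ i) (binomial_transform c) 0"
    by (intro forward_diff_cong) auto
  then show ?thesis by (simp add: forward_diff_binomial_transform, simp add: binomial_transform_def)
qed

lemma polyflow_trajectory_exp_poly:
  fixes f :: "real^'n \<Rightarrow> real^'n"
  assumes "N \<ge> 1"
  shows "polyflow_trajectory f N (\<lambda>i. (- real (N choose i)) *\<^sub>R mat 1) x0
    (exp_poly N (binomial_transform (\<lambda>i. lie_derivative_vec f i id x0)) 0)"
proof -
  define d where "d = binomial_transform (\<lambda>i. lie_derivative_vec f i id x0)"
  \<comment> \<open>Only indices below \<open>N\<close> are blocks; \<open>z N\<close> serves as the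
    derivative of the last block.\<close>
  define z where "z = (\<lambda>i t. (forward_diff ^^ i) (\<lambda>j. exp_poly N d j t) 0)"
  have z: "(z i has_vector_derivative z (Suc i) t) (at t)" for i t
    unfolding z_def by (rule exp_poly_forward_diff_has_vector_derivative)
  have "(\<Sum>i<N. ((- real (N choose i)) *\<^sub>R mat 1 :: real^'n^'n) *v z i t) = z N t" for t
    using exp_poly_forward_diff_sum[of N d t]
    by (simp only: scaleR_matrix_vector_assoc[symmetric] matrix_vector_mul_lid z_def)
  with z[of "N - 1"] assms
  have "polyflow_solution N (\<lambda>i. (- real (N choose i)) *\<^sub>R mat 1) z"
    unfolding polyflow_solution_def using z by simp
  moreover have "z i 0 = lie_derivative_vec f i id x0" if "i < N" for i
    using exp_poly_initial[OF that] by (simp add: z_def d_def)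
  moreover have "z 0 = exp_poly N d 0" by (auto simp: z_def)
  ultimately show ?thesis unfolding polyflow_trajectory_def d_def by metis
qed

lemma exp_poly_tendsto_0: "(exp_poly N d j \<longlongrightarrow> 0) at_top"
proof -
  have "((\<lambda>t. \<Sum>l<N - j. ((t ^ l / exp t) / fact l) *\<^sub>R d (j + l)) \<longlongrightarrow>
      (\<Sum>l<N - j. (0 / fact l) *\<^sub>R d (j + l))) at_top"
    by (intro tendsto_intros tendsto_power_div_exp_0) simp
  moreover have "exp_poly N d j = (\<lambda>t. \<Sum>l<N - j. ((t ^ l / exp t) / fact l) *\<^sub>R d (j + l))"
    by (auto simp: exp_poly_def scaleR_sum_right exp_minus field_simps)
  ultimately show ?thesis by simp
qed

text \<open>Mertens' theorem for the given series and the exponential series: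
  \<open>exp_poly\<close> at index 0 is \<open>exp (- t)\<close> times a partial sum of their
  product.\<close>

lemma exp_poly_tendsto_power_series:
  fixes c :: "nat \<Rightarrow> real"
  assumes "(\<lambda>i. (c i / fact i) * t ^ i) sums s" "summable (\<lambda>i. norm ((c i / fact i) * t ^ i))"
  shows "(\<lambda>N. exp_poly N (binomial_transform c) 0 t) \<longlonglongrightarrow> s"
proof -
  have "summable (\<lambda>k. norm (t ^ k /\<^sub>R fact k))" by (rule summable_norm_exp)
  from Cauchy_product_sums[OF assms(2) this]
  have "(\<lambda>k. \<Sum>i\<le>k. (c i / fact i * t ^ i) * (t ^ (k - i) /\<^sub>R fact (k - i))) sums (s * exp t)"
    by (simp only: sums_unique[OF assms(1), symmetric] exp_def)
  moreover have "(\<Sum>i\<le>k. (c i / fact i * t ^ i) * (t ^ (k - i) /\<^sub>R fact (k - i)))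
      = (t ^ k / fact k) *\<^sub>R binomial_transform c k" for k
  proof -
    have "(c i / fact i * t ^ i) * (t ^ (k - i) /\<^sub>R fact (k - i))
        = (t ^ k / fact k) *\<^sub>R (real (k choose i) *\<^sub>R c i)" if "i \<le> k" for i
    proof -
      have "(c i / fact i * t ^ i) * (t ^ (k - i) /\<^sub>R fact (k - i))
          = (t ^ i * t ^ (k - i)) * c i / (fact i * fact (k - i))"
        by (simp add: divide_inverse)
      also have "t ^ i * t ^ (k - i) = t ^ k" using that by (simp flip: power_add)
      finally show ?thesis using that by (simp add: binomial_fact)
    qed
    then show ?thesis by (simp add: binomial_transform_def sum_distrib_left sum_divide_distrib)
  qed
  ultimately have "(\<lambda>N. exp (- t) * (\<Sum>k<N. (t ^ k / fact k) *\<^sub>R binomial_transform c k))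
      \<longlonglongrightarrow> exp (- t) * (s * exp t)"
    unfolding sums_def by (intro tendsto_mult_left) simp
  moreover have "exp (- t) * (s * exp t) = s" by (simp add: exp_minus)
  ultimately show ?thesis by (simp add: exp_poly_def)
qed

lemma exp_poly_component: "exp_poly N d j t $ k = exp_poly N (\<lambda>i. d i $ k) j t"
  by (simp add: exp_poly_def)

lemma binomial_transform_component:
  "binomial_transform c j $ k = binomial_transform (\<lambda>i. c i $ k) j"
  by (simp add: binomial_transform_def)

theorem theorem3:
  fixes f :: "real^'n \<Rightarrow> real^'n"
  assumes "smooth f"
  shows "\<exists>(\<Lambda> :: nat \<Rightarrow> nat \<Rightarrow> real^'n^'n) (\<pi> :: nat \<Rightarrow> real^'n \<Rightarrow> real \<Rightarrow> real^'n).
    (\<forall>N\<ge>1. \<forall>x0. polyflow_trajectory f N (\<Lambda> N) x0 (\<pi> N x0)) \<and>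
    (\<forall>x0. \<forall>N\<ge>1. (\<pi> N x0 \<longlongrightarrow> 0) at_top) \<and>
    (\<forall>x0 J \<psi>. ivp_solution f x0 J \<psi> \<and> real_analytic_curve_on \<psi> J \<longrightarrow>
      (\<forall>t\<in>J. ereal \<bar>t\<bar> < taylor_radius f x0 \<longrightarrow> (\<lambda>N. \<pi> N x0 t) \<longlonglongrightarrow> \<psi> t))"
proof (intro exI conjI allI impI ballI)
  let ?\<pi> = "\<lambda>N x0. exp_poly N (binomial_transform (\<lambda>i. lie_derivative_vec f i id x0)) 0"
  show "polyflow_trajectory f N (\<lambda>i. (- real (N choose i)) *\<^sub>R mat 1) x0 (?\<pi> N x0)" if "N \<ge> 1" for N x0
    using that by (rule polyflow_trajectory_exp_poly)
  show "(?\<pi> N x0 \<longlongrightarrow> 0) at_top" for N x0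
    by (rule exp_poly_tendsto_0)
  fix x0 J \<psi> t
  assume sol: "ivp_solution f x0 J \<psi> \<and> real_analytic_curve_on \<psi> J" and t: "t \<in> J"
    and rad: "ereal \<bar>t\<bar> < taylor_radius f x0"
  \<comment> \<open>The radius may be infinite, hence a real \<open>R\<close>. Since it lies
    strictly below the radius, the series converges at \<open>R\<close> itself, which makes it
    absolutely convergent at \<open>t\<close>.\<close>
  from rad obtain R where R: "\<bar>t\<bar> < R" "ereal R < taylor_radius f x0"
    using ereal_dense2 by (metis less_ereal.simps(1))
  show "(\<lambda>N. ?\<pi> N x0 t) \<longlonglongrightarrow> \<psi> t"
  proof (rule vec_tendstoI)
    fix k
    let ?c = "\<lambda>i. lie_derivative_vec f i id x0 $ k"
    have sm: "summable (\<lambda>i. (?c i / fact i) * u ^ i)" if "\<bar>u\<bar> \<le> R" for u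
      using that R(2) by (intro summable_taylor_component) (metis ereal_less_eq(3) le_less_trans)
    have "(\<lambda>i. (?c i / fact i) * t ^ i) sums (\<psi> t $ k)"
      using sol t R(1) sm
      by (intro taylor_series_sums_solution[where R = R, OF assms]) auto
    moreover have "summable (\<lambda>i. norm ((?c i / fact i) * t ^ i))"
      by (rule powser_insidea[where x = R]) (use sm[of R] R in auto)
    ultimately have "(\<lambda>N. exp_poly N (binomial_transform ?c) 0 t) \<longlonglongrightarrow> \<psi> t $ k"
      by (rule exp_poly_tendsto_power_series)
    then show "(\<lambda>N. ?\<pi> N x0 t $ k) \<longlonglongrightarrow> \<psi> t $ k"
      by (simp add: exp_poly_component binomial_transform_component)
  qed
qed

end
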